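(* Let $f:\mathbb{R}\to\mathbb{R}$ be a $\mathcal{C}^\infty$ function all of whose derivatives grow at most polynomially at infinity, with $f''>0$ on $\mathbb{R}$, and suppose there are $R>0$, $\beta_-\geqslant\beta_+>1$ and $c_+,c_->0$ such that $$\forall\,|p|\geqslant R\qquad c_-\,|p|^{-\beta_-}\leqslant f''(p)\leqslant c_+\,|p|^{-\beta_+}.$$ Let $\mu\in(0,1]$, $\alpha>\mu+\beta_--1$ and $0\leqslant r\leqslant R$. Let $u_0$ be a tempered distribution on $\mathbb{R}$ for which there is a bounded differentiable function $\tilde u:\mathbb{R}\to\mathbb{C}$, with $\tilde u(0)\neq0$ if $\mu\neq1$, such that $$\mathcal{F}u_0(p)=|p|^{\mu-1}\,\tilde u(p)\qquad\text{for all }p\in\mathbb{R}\setminus\{0\},$$ such that for some $M\geqslant0$ one has $|\tilde u(p)|\leqslant M(1+p^2)^{-\frac\alpha2}$ for all $p\in\mathbb{R}$, and such that $\tilde u'\in L^1_{loc}(\mathbb{R})$ and for some $M'\geqslant0$ one has $\|\tilde u'\|_{L^1(n,n+1)}\leqslant M'|n|^{-\alpha}$ for all $n\in\mathbb{Z}$ with $|n|\geqslant r$. Let $u$ be the solution of $[i\partial_t-f(D)]u=0$, $u(0,\cdot)=u_0$, given by $$u(t,x)=\frac{1}{2\pi}\int_{\mathbb{R}}\mathcal{F}u_0(p)\,e^{-itf(p)+ixp}\,dp ,\qquad t>0,\ x\in\mathbb{R}.$$ Let $a<b$ be the two finite real numbers given by $$a=\lim_{p\to-\infty}f'(p),\qquad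 b=\lim_{p\to+\infty}f'(p)$$ (these limits exist and are finite under the hypotheses on $f$). Then $$\forall\,(t,x)\in\mathfrak{C}(a,b)^c\qquad|u(t,x)|\leqslant c_1^c(u_0,f)\,t^{-\mu}+c_2^c(u_0,f)\,t^{-1},$$ where, with $N:=\lceil R\rceil+1$, $m_{-N}:=\min\{f'(-N)-a,\;b-f'(0)\}>0$ and $m_{+N}:=\min\{f'(0)-a,\;b-f'(N)\}>0$, $$c_1^c(u_0,f):=\frac1{2\pi}\,\frac1\mu\,\|\tilde u\|_{L^\infty(-N,0)}+\frac1{2\pi}\Big(4\|\tilde u\|_{L^\infty(-N,0)}+\|\tilde u'\|_{L^1(-N,0)}\Big)m_{-N}^{-1}$$ $$\qquad\qquad+\frac1{2\pi}\,\frac1\mu\,\|\tilde u\|_{L^\infty(0,N)}+\frac1{2\pi}\Big(4\|\tilde u\|_{L^\infty(0,N)}+\|\tilde u'\|_{L^1(0,N)}\Big)m_{+N}^{-1},$$ and $$c_2^c(u_0,f):=\frac{\beta_--1}{\pi\,c_-}\Big(3\cdot2^{-\mu+\alpha+\beta_-}M+2^{-\mu+\beta_-}\big(2^\alpha M+M'\big)\Big)\frac{\alpha+2-\mu-\beta_-}{\alpha+1-\mu-\beta_-}.$$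
   Context: Fourier transform convention: $\mathcal{F}v(p)=\int_{\mathbb{R}}v(x)e^{-ixp}\,dx$, extended to tempered distributions. $f(D)$ is the Fourier multiplier $f(D)v=\mathcal{F}^{-1}(f\,\mathcal{F}v)$. Under the hypotheses ($\alpha>\mu$) one has $\mathcal{F}u_0\in L^1(\mathbb{R})$, so the formula for $u$ is well defined for all $t>0$, $x\in\mathbb{R}$. $\lceil\cdot\rceil$ is the ceiling function. Space-time cones: for real $a<b$, $\mathfrak{C}(a,b):=\{(t,x)\in(0,+\infty)\times\mathbb{R} : a\leqslant \frac{x}{t}\leqslant b\}$ and $\mathfrak{C}(a,b)^c:=\big((0,+\infty)\times\mathbb{R}\big)\setminus\mathfrak{C}(a,b)$. *)

theory Defs
  imports "HOL-Analysis.Analysis" "HOL-Probability.Essential_Supremum"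
begin

definition smooth_poly_growth :: "(real \<Rightarrow> real) \<Rightarrow> bool" where
  "smooth_poly_growth f \<longleftrightarrow>
     (\<forall>k p. ((deriv ^^ k) f) field_differentiable (at p)) \<and>
     (\<forall>k. \<exists>(C::real) (m::nat). \<forall>p. \<bar>(deriv ^^ k) f p\<bar> \<le> C * (1 + \<bar>p\<bar>) ^ m)"

definition D1 :: "(real \<Rightarrow> complex) \<Rightarrow> real \<Rightarrow> complex" where
  "D1 v = (\<lambda>x. vector_derivative v (at x))"

definition schwartz :: "(real \<Rightarrow> complex) set" where
  "schwartz =
     {\<phi>. (\<forall>l x. ((D1 ^^ l) \<phi>) differentiable (at x)) \<and>
          (\<forall>j l. bounded (range (\<lambda>x. x ^ j *\<^sub>R (D1 ^^ l) \<phi> x)))}"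

definition schwartz_seminorm :: "nat \<Rightarrow> nat \<Rightarrow> (real \<Rightarrow> complex) \<Rightarrow> real" where
  "schwartz_seminorm j l \<phi> = (SUP x. norm (x ^ j *\<^sub>R (D1 ^^ l) \<phi> x))"

text \<open>A tempered distribution is a functional on all functions of which only the values on
  \<open>schwartz\<close> matter; continuity is domination by finitely many seminorms.\<close>

definition tempered_distribution :: "((real \<Rightarrow> complex) \<Rightarrow> complex) \<Rightarrow> bool" where
  "tempered_distribution T \<longleftrightarrow>
     (\<forall>\<phi>\<in>schwartz. \<forall>\<psi>\<in>schwartz. T (\<lambda>x. \<phi> x + \<psi> x) = T \<phi> + T \<psi>) \<and>
     (\<forall>\<phi>\<in>schwartz. \<forall>c. T (\<lambda>x. c * \<phi> x) = c * T \<phi>) \<and>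
     (\<exists>C k. \<forall>\<phi>\<in>schwartz. norm (T \<phi>) \<le> C * (\<Sum>j\<le>k. \<Sum>l\<le>k. schwartz_seminorm j l \<phi>))"

definition fourier :: "(real \<Rightarrow> complex) \<Rightarrow> real \<Rightarrow> complex" where
  "fourier v p =
     (LINT x|lborel. v x * exp (- \<i> * complex_of_real x * complex_of_real p))"

definition fourier_distr :: "((real \<Rightarrow> complex) \<Rightarrow> complex) \<Rightarrow> (real \<Rightarrow> complex) \<Rightarrow> complex" where
  "fourier_distr T \<phi> = T (fourier \<phi>)"

text \<open>\<open>is_regular T g\<close>: the distribution \<open>T\<close> is the function \<open>g\<close>. Testing
  against a Gaussian shows that \<open>g\<close> is then locally integrable.\<close>

definition is_regular :: "((real \<Rightarrow> complex) \<Rightarrow> complex) \<Rightarrow> (real \<Rightarrow> complex) \<Rightarrow> bool" where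
  "is_regular T g \<longleftrightarrow>
     (\<forall>\<phi>\<in>schwartz. integrable lborel (\<lambda>p. g p * \<phi> p) \<and>
                  T \<phi> = (LINT p|lborel. g p * \<phi> p))"

definition L1_norm_on :: "real set \<Rightarrow> (real \<Rightarrow> complex) \<Rightarrow> real" where
  "L1_norm_on S g = (LINT x:S|lborel. norm (g x))"

text \<open>\<open>esssup\<close> needs a complete linear order, hence the passage through \<open>ereal\<close>.
  The norm is only used for functions that are measurable and bounded.\<close>

definition Linf_norm_on :: "real set \<Rightarrow> (real \<Rightarrow> complex) \<Rightarrow> real" where
  "Linf_norm_on S g =
     real_of_ereal (esssup (restrict_space lborel S) (\<lambda>x. ereal (norm (g x))))"

definition L1_loc :: "(real \<Rightarrow> complex) \<Rightarrow> bool" where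
  "L1_loc g \<longleftrightarrow> (\<forall>K. compact K \<longrightarrow> set_integrable lborel K g)"

text \<open>The solution of \<open>(i \<partial>\<^sub>t - f(D)) u = 0\<close> whose initial datum has Fourier transform
  \<open>g\<close>, that is \<open>u(t, \<cdot>) = F\<^sup>-\<^sup>1 (exp (-i t f) g)\<close>.\<close>

definition solution :: "(real \<Rightarrow> real) \<Rightarrow> (real \<Rightarrow> complex) \<Rightarrow> real \<Rightarrow> real \<Rightarrow> complex" where
  "solution f g t x =
     complex_of_real (1 / (2 * pi)) *
     (LINT p|lborel. g p * exp (- \<i> * complex_of_real t * complex_of_real (f p)
                                + \<i> * complex_of_real x * complex_of_real p))"

definition cone :: "real \<Rightarrow> real \<Rightarrow> (real \<times> real) set" where
  "cone a b = {(t, x). t > 0 \<and> a \<le> x / t \<and> x / t \<le> b}"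

definition cone_compl :: "real \<Rightarrow> real \<Rightarrow> (real \<times> real) set" where
  "cone_compl a b = ({0<..} \<times> UNIV) - cone a b"

definition m_neg :: "(real \<Rightarrow> real) \<Rightarrow> real \<Rightarrow> real \<Rightarrow> real \<Rightarrow> real" where
  "m_neg f a b N = min (deriv f (- N) - a) (b - deriv f 0)"

definition m_pos :: "(real \<Rightarrow> real) \<Rightarrow> real \<Rightarrow> real \<Rightarrow> real \<Rightarrow> real" where
  "m_pos f a b N = min (deriv f 0 - a) (b - deriv f N)"

definition c1 ::
  "(real \<Rightarrow> real) \<Rightarrow> real \<Rightarrow> real \<Rightarrow> real \<Rightarrow> real \<Rightarrow> (real \<Rightarrow> complex) \<Rightarrow> real" where
  "c1 f a b N \<mu> v =
     1 / (2 * pi) * (1 / \<mu>) * Linf_norm_on {- N<..<0} v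
   + 1 / (2 * pi) * (4 * Linf_norm_on {- N<..<0} v + L1_norm_on {- N<..<0} (D1 v))
       * inverse (m_neg f a b N)
   + 1 / (2 * pi) * (1 / \<mu>) * Linf_norm_on {0<..<N} v
   + 1 / (2 * pi) * (4 * Linf_norm_on {0<..<N} v + L1_norm_on {0<..<N} (D1 v))
       * inverse (m_pos f a b N)"

definition c2 :: "real \<Rightarrow> real \<Rightarrow> real \<Rightarrow> real \<Rightarrow> real \<Rightarrow> real \<Rightarrow> real" where
  "c2 c\<^sub>m \<beta>\<^sub>m \<mu> \<alpha> M M' =
     (\<beta>\<^sub>m - 1) / (pi * c\<^sub>m)
     * (3 * 2 powr (- \<mu> + \<alpha> + \<beta>\<^sub>m) * M + 2 powr (- \<mu> + \<beta>\<^sub>m) * (2 powr \<alpha> * M + M'))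
     * ((\<alpha> + 2 - \<mu> - \<beta>\<^sub>m) / (\<alpha> + 1 - \<mu> - \<beta>\<^sub>m))"

end

theory Submission
  imports Defs
begin

text \<open>
  Outside the cone the phase \<open>x p - t f p\<close> has no stationary point: its derivative has constant
  sign and is at least \<open>t\<close> times the distance from \<open>f' p\<close> to \<open>a\<close> or \<open>b\<close>, a distance that the
  lower bound on \<open>f''\<close> keeps above a multiple of \<open>\<bar>p\<bar>\<close> to the power \<open>1 - \<beta>\<^sub>m\<close>. On each half-line
  the singular factor \<open>\<bar>p\<bar> powr (\<mu> - 1)\<close> is integrated directly up to \<open>1 / t\<close>; on
  \<open>[1 / t, N]\<close> and on each unit interval beyond \<open>N\<close> one integration by parts gains a factor
  \<open>1 / t\<close>, and the contributions of the unit intervals form a convergent series of powers.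
\<close>

section \<open>Integration by parts against a non-stationary phase\<close>

text \<open>Dividing \<open>cis (\<phi> p)\<close> by \<open>\<i> * \<phi>1 p\<close> gives a
  function whose derivative returns \<open>cis (\<phi> p)\<close> up to the term where
  \<open>1 / \<phi>1\<close> is differentiated. Of the three copies of \<open>G\<close>, two pay for
  the boundary values and one for the variation of \<open>1 / \<phi>1\<close>; concavity of the
  phase keeps the latter monotone. The derivative of the amplitude enters only through an integrable
  majorant \<open>h\<close>.\<close>

lemma nonstationary_phase_bound:
  fixes g g1 :: "real \<Rightarrow> complex" and \<phi> \<phi>1 \<phi>2 h :: "real \<Rightarrow> real"
  assumes cd: "c \<le> d"
    and g: "\<And>p. p \<in> {c..d} \<Longrightarrow> (g has_vector_derivative g1 p) (at p within {c..d})"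
    and \<phi>: "\<And>p. p \<in> {c..d} \<Longrightarrow> (\<phi> has_real_derivative \<phi>1 p) (at p within {c..d})"
    and \<phi>1: "\<And>p. p \<in> {c..d} \<Longrightarrow> (\<phi>1 has_real_derivative \<phi>2 p) (at p within {c..d})"
    and \<phi>2: "\<And>p. p \<in> {c..d} \<Longrightarrow> \<phi>2 p \<le> 0"
    and K: "K > 0"
    and sign: "(\<forall>p\<in>{c..d}. K \<le> \<phi>1 p) \<or> (\<forall>p\<in>{c..d}. \<phi>1 p \<le> - K)"
    and G: "\<And>p. p \<in> {c..d} \<Longrightarrow> norm (g p) \<le> G"
    and h: "\<And>p. p \<in> {c..d} \<Longrightarrow> norm (g1 p) \<le> h p" "(h has_integral H) {c..d}"
  shows "norm (integral {c..d} (\<lambda>p. g p * cis (\<phi> p))) \<le> (3 * G + H) / K"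
proof -
  define q where "q = (\<lambda>p. g p * cis (\<phi> p))"
  define W where "W = (\<lambda>p. inverse (\<phi>1 p) *\<^sub>R (g p * cis (\<phi> p) / \<i>))"
  \<comment> \<open>\<open>g1\<close> need not be continuous: \<open>E\<close> is integrable because it is the difference of the derivative
    of \<open>W\<close> and the continuous function \<open>q\<close>.\<close>
  define E where "E = (\<lambda>p. (inverse (\<phi>1 p) *\<^sub>R g1 p - (\<phi>2 p / (\<phi>1 p)\<^sup>2) *\<^sub>R g p) * cis (\<phi> p) / \<i>)"
  have K_le: "K \<le> \<bar>\<phi>1 p\<bar>" if "p \<in> {c..d}" for p
    using sign that K by fastforce
  have nz: "\<phi>1 p \<noteq> 0" if "p \<in> {c..d}" for p
    using K_le[OF that] K by auto
  have cis_der: "((\<lambda>p. cis (\<phi> p)) has_vector_derivative \<phi>1 p *\<^sub>R (\<i> * cis (\<phi> p))) (at p within {c..d})"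
    if "p \<in> {c..d}" for p
    using has_derivative_cis[OF \<phi>[OF that, unfolded has_field_derivative_def]]
    by (simp add: has_vector_derivative_def scaleR_conv_of_real mult.commute mult.left_commute)
  have inv_der: "((\<lambda>p. inverse (\<phi>1 p)) has_real_derivative - (\<phi>2 p / (\<phi>1 p)\<^sup>2)) (at p within {c..d})"
    if "p \<in> {c..d}" for p
    using DERIV_inverse_fun[OF \<phi>1[OF that] nz[OF that]]
    by (simp add: power2_eq_square divide_inverse mult.commute mult.left_commute)
  have W_der: "(W has_vector_derivative (q p + E p)) (at p within {c..d})" if p: "p \<in> {c..d}" for p
  proof -
    have "((\<lambda>p. g p * cis (\<phi> p)) has_vector_derivative
        g p * (\<phi>1 p *\<^sub>R (\<i> * cis (\<phi> p))) + g1 p * cis (\<phi> p)) (at p within {c..d})"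
      using has_vector_derivative_mult[OF g[OF p] cis_der[OF p]] by simp
    then have "((\<lambda>p. g p * cis (\<phi> p) / \<i>) has_vector_derivative
        (g p * (\<phi>1 p *\<^sub>R (\<i> * cis (\<phi> p))) + g1 p * cis (\<phi> p)) / \<i>) (at p within {c..d})"
      by (rule has_vector_derivative_divide)
    from has_vector_derivative_scaleR[OF inv_der[OF p] this]
    show ?thesis
      unfolding W_def
      by (rule has_vector_derivative_eq_rhs)
        (use nz[OF p] in \<open>simp add: q_def E_def scaleR_conv_of_real field_simps power2_eq_square\<close>)
  qed
  have qE: "((\<lambda>p. q p + E p) has_integral (W d - W c)) {c..d}"
    by (rule fundamental_theorem_of_calculus[OF cd W_der])
  have "continuous_on {c..d} q"
    unfolding q_def
    by (intro continuous_on_mult continuous_on_vector_derivative[OF g]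
        continuous_on_vector_derivative[OF cis_der])
  then have q_int: "q integrable_on {c..d}"
    by (rule integrable_continuous_real)
  have "((\<lambda>p. (q p + E p) - q p) has_integral (W d - W c) - integral {c..d} q) {c..d}"
    by (rule has_integral_diff[OF qE integrable_integral[OF q_int]])
  then have E_int: "(E has_integral (W d - W c) - integral {c..d} q) {c..d}"
    by simp
  \<comment> \<open>\<open>1 / \<phi>1\<close> is monotone since \<open>\<phi>2 \<le> 0\<close>, so its total variation is just a difference of end values.\<close>
  have var: "((\<lambda>p. - (\<phi>2 p / (\<phi>1 p)\<^sup>2)) has_integral (inverse (\<phi>1 d) - inverse (\<phi>1 c))) {c..d}"
    using inv_der by (intro fundamental_theorem_of_calculus[OF cd])
      (simp add: has_real_derivative_iff_has_vector_derivative)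
  define B where "B = (\<lambda>p. inverse K * h p + G * - (\<phi>2 p / (\<phi>1 p)\<^sup>2))"
  have B_int: "(B has_integral inverse K * H + G * (inverse (\<phi>1 d) - inverse (\<phi>1 c))) {c..d}"
    unfolding B_def by (intro has_integral_add has_integral_mult_right h var)
  have E_le: "norm (E p) \<le> B p" if p: "p \<in> {c..d}" for p
  proof -
    have "norm (E p) \<le> norm (inverse (\<phi>1 p) *\<^sub>R g1 p) + norm ((\<phi>2 p / (\<phi>1 p)\<^sup>2) *\<^sub>R g p)"
      unfolding E_def by (simp add: norm_mult norm_divide norm_triangle_ineq4 del: norm_scaleR)
    also have "\<dots> = inverse \<bar>\<phi>1 p\<bar> * norm (g1 p) + - (\<phi>2 p / (\<phi>1 p)\<^sup>2) * norm (g p)"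
      using \<phi>2[OF p] by (simp add: abs_divide)
    also have "inverse \<bar>\<phi>1 p\<bar> * norm (g1 p) \<le> inverse K * h p"
      using K_le[OF p] K h(1)[OF p] by (intro mult_mono) auto
    also have "- (\<phi>2 p / (\<phi>1 p)\<^sup>2) * norm (g p) \<le> - (\<phi>2 p / (\<phi>1 p)\<^sup>2) * G"
      using \<phi>2[OF p] G[OF p] by (intro mult_left_mono) (auto intro: divide_nonpos_nonneg)
    finally show ?thesis by (simp add: B_def mult.commute)
  qed
  have "norm (integral {c..d} E) \<le> integral {c..d} B"
    using E_int B_int E_le by (intro integral_norm_bound_integral) auto
  then have E_bound: "norm ((W d - W c) - integral {c..d} q)
      \<le> inverse K * H + G * (inverse (\<phi>1 d) - inverse (\<phi>1 c))"
    using E_int B_int by (simp add: integral_unique)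
  have c: "c \<in> {c..d}" and d: "d \<in> {c..d}" using cd by auto
  have G0: "0 \<le> G" using G[OF c] norm_ge_zero[of "g c"] by linarith
  \<comment> \<open>As \<open>\<phi>1\<close> has constant sign, both inverses lie in
    \<open>{0..inverse K}\<close> or both in \<open>{- inverse K..0}\<close>, so their difference
    costs one \<open>inverse K\<close> and not two.\<close>
  have inv_le: "inverse (\<phi>1 d) - inverse (\<phi>1 c) \<le> inverse K"
    using sign
  proof
    assume *: "\<forall>p\<in>{c..d}. K \<le> \<phi>1 p"
    then have "inverse (\<phi>1 d) \<le> inverse K" "0 \<le> inverse (\<phi>1 c)"
      using K c d by (auto intro!: le_imp_inverse_le intro: order_trans[of 0 K])
    then show ?thesis by linarith
  next
    assume *: "\<forall>p\<in>{c..d}. \<phi>1 p \<le> - K"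
    then have "\<phi>1 c \<le> - K" "\<phi>1 d \<le> - K" using c d by auto
    then have "inverse (- \<phi>1 c) \<le> inverse K" "0 \<le> inverse (- \<phi>1 d)"
      using K by (auto intro!: le_imp_inverse_le simp: le_minus_iff simp del: inverse_minus_eq)
    moreover have "inverse (- \<phi>1 c) = - inverse (\<phi>1 c)" "inverse (- \<phi>1 d) = - inverse (\<phi>1 d)"
      by simp_all
    ultimately show ?thesis by linarith
  qed
  have W_le: "norm (W p) \<le> G * inverse K" if p: "p \<in> {c..d}" for p
  proof -
    have "norm (W p) = norm (g p) * inverse \<bar>\<phi>1 p\<bar>"
      by (simp add: W_def norm_mult norm_divide)
    also have "\<dots> \<le> G * inverse K"
      using K_le[OF p] K G[OF p] G0 by (intro mult_mono) auto
    finally show ?thesis .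
  qed
  have "norm (integral {c..d} q) \<le> norm (W d - W c) + norm ((W d - W c) - integral {c..d} q)"
    by (metis add_diff_cancel_left' diff_add_cancel norm_triangle_ineq4)
  also have "\<dots> \<le> (G * inverse K + G * inverse K) + (inverse K * H + G * inverse K)"
  proof (rule add_mono)
    show "norm (W d - W c) \<le> G * inverse K + G * inverse K"
      using norm_triangle_ineq4[of "W d" "W c"] W_le[OF c] W_le[OF d] by linarith
    show "norm ((W d - W c) - integral {c..d} q) \<le> inverse K * H + G * inverse K"
      using E_bound mult_left_mono[OF inv_le G0] by linarith
  qed
  finally show ?thesis
    by (simp add: q_def divide_inverse algebra_simps)
qed

text \<open>The weight is absorbed into the amplitude. For \<open>\<mu> \<le> 1\<close> it is
  nonincreasing, so its supremum is its value at the left end \<open>c\<close> and its total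
  variation is at most that value. The variation adds one \<open>L\<close> to the three of the
  unweighted bound, hence \<open>4 * L\<close>.\<close>

lemma weighted_nonstationary_phase_bound:
  fixes v v1 :: "real \<Rightarrow> complex" and \<phi> \<phi>1 \<phi>2 :: "real \<Rightarrow> real"
  assumes c: "0 < c" and cd: "c \<le> d" and \<mu>: "\<mu> \<le> 1"
    and v: "\<And>p. (v has_vector_derivative v1 p) (at p)"
    and v1: "(\<lambda>p. norm (v1 p)) integrable_on {c..d}"
    and V: "integral {c..d} (\<lambda>p. norm (v1 p)) \<le> V"
    and \<phi>: "\<And>p. (\<phi> has_real_derivative \<phi>1 p) (at p)"
    and \<phi>1: "\<And>p. (\<phi>1 has_real_derivative \<phi>2 p) (at p)"
    and \<phi>2: "\<And>p. \<phi>2 p \<le> 0"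
    and K: "K > 0"
    and sign: "(\<forall>p\<in>{c..d}. K \<le> \<phi>1 p) \<or> (\<forall>p\<in>{c..d}. \<phi>1 p \<le> - K)"
    and L: "\<And>p. p \<in> {c..d} \<Longrightarrow> norm (v p) \<le> L"
  shows "norm (integral {c..d} (\<lambda>p. complex_of_real (p powr (\<mu> - 1)) * v p * cis (\<phi> p)))
    \<le> (4 * L + V) * c powr (\<mu> - 1) / K"
proof -
  define g where "g = (\<lambda>p. p powr (\<mu> - 1) *\<^sub>R v p)"
  define g1 where "g1 = (\<lambda>p. p powr (\<mu> - 1) *\<^sub>R v1 p + ((\<mu> - 1) * p powr (\<mu> - 2)) *\<^sub>R v p)"
  define h where "h = (\<lambda>p. c powr (\<mu> - 1) * norm (v1 p) + L * - ((\<mu> - 1) * p powr (\<mu> - 2)))"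
  have L0: "0 \<le> L" using L[of c] cd norm_ge_zero[of "v c"] by (meson atLeastAtMost_iff order.trans order_refl)
  have w_der: "((\<lambda>p. p powr (\<mu> - 1)) has_real_derivative (\<mu> - 1) * p powr (\<mu> - 2)) (at p within {c..d})"
    if "p \<in> {c..d}" for p
    using has_real_derivative_powr[of p "\<mu> - 1"] that c by (auto intro: has_field_derivative_at_within)
  have w_le: "p powr (\<mu> - 1) \<le> c powr (\<mu> - 1)" if "p \<in> {c..d}" for p
    using that c \<mu> by (intro powr_mono2') auto
  have g_der: "(g has_vector_derivative g1 p) (at p within {c..d})" if p: "p \<in> {c..d}" for p
    unfolding g_def g1_def
    by (rule has_vector_derivative_scaleR[OF w_der[OF p] has_vector_derivative_at_within[OF v]])
  have g_le: "norm (g p) \<le> c powr (\<mu> - 1) * L" if p: "p \<in> {c..d}" for p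
    using w_le[OF p] L[OF p] by (simp add: g_def mult_mono)
  have g1_le: "norm (g1 p) \<le> h p" if p: "p \<in> {c..d}" for p
  proof -
    have "norm (g1 p) \<le> p powr (\<mu> - 1) * norm (v1 p) + \<bar>(\<mu> - 1) * p powr (\<mu> - 2)\<bar> * norm (v p)"
      unfolding g1_def by (intro order_trans[OF norm_triangle_ineq]) simp
    also have "\<bar>(\<mu> - 1) * p powr (\<mu> - 2)\<bar> = - ((\<mu> - 1) * p powr (\<mu> - 2))"
      using \<mu> by (intro abs_of_nonpos) (simp add: mult_le_0_iff)
    also have "p powr (\<mu> - 1) * norm (v1 p) + - ((\<mu> - 1) * p powr (\<mu> - 2)) * norm (v p)
        \<le> c powr (\<mu> - 1) * norm (v1 p) + - ((\<mu> - 1) * p powr (\<mu> - 2)) * L"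
      using w_le[OF p] L[OF p] \<mu> by (intro add_mono mult_right_mono mult_left_mono) (auto simp: mult_le_0_iff)
    finally show ?thesis by (simp add: h_def mult.commute)
  qed
  have "((\<lambda>p. (\<mu> - 1) * p powr (\<mu> - 2)) has_integral (d powr (\<mu> - 1) - c powr (\<mu> - 1))) {c..d}"
    using w_der by (intro fundamental_theorem_of_calculus[OF cd])
      (simp add: has_real_derivative_iff_has_vector_derivative)
  then have h_int: "(h has_integral c powr (\<mu> - 1) * integral {c..d} (\<lambda>p. norm (v1 p))
      + L * - (d powr (\<mu> - 1) - c powr (\<mu> - 1))) {c..d}"
    unfolding h_def
    by (intro has_integral_add has_integral_mult_right has_integral_neg integrable_integral[OF v1])
  have "norm (integral {c..d} (\<lambda>p. g p * cis (\<phi> p))) \<le> (3 * (c powr (\<mu> - 1) * L)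
      + (c powr (\<mu> - 1) * integral {c..d} (\<lambda>p. norm (v1 p)) + L * - (d powr (\<mu> - 1) - c powr (\<mu> - 1)))) / K"
    by (rule nonstationary_phase_bound[OF cd g_der _ _ \<phi>2 K sign g_le g1_le h_int])
      (auto intro: has_field_derivative_at_within \<phi> \<phi>1)
  also have "\<dots> \<le> ((4 * L + V) * c powr (\<mu> - 1)) / K"
  proof (rule divide_right_mono)
    have "c powr (\<mu> - 1) * integral {c..d} (\<lambda>p. norm (v1 p)) \<le> c powr (\<mu> - 1) * V"
      using V by (rule mult_left_mono) simp
    \<comment> \<open>The weight varies by \<open>c powr (\<mu> - 1) - d powr (\<mu> - 1)\<close>;
      discarding the second term leaves a bound that does not depend on \<open>d\<close>.\<close>
    moreover have "0 \<le> L * d powr (\<mu> - 1)" using L0 by simp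
    ultimately show "3 * (c powr (\<mu> - 1) * L) + (c powr (\<mu> - 1) * integral {c..d} (\<lambda>p. norm (v1 p))
        + L * - (d powr (\<mu> - 1) - c powr (\<mu> - 1))) \<le> (4 * L + V) * c powr (\<mu> - 1)"
      by (simp add: algebra_simps)
  qed (use K in simp)
  finally show ?thesis by (simp add: g_def scaleR_conv_of_real)
qed

section \<open>Sums of powers and decomposition into unit intervals\<close>

text \<open>Comparison with the integral of \<open>x powr (- s)\<close>, one term at a time: by the
  mean value theorem each term is at most the increment of an antiderivative over
  \<open>{real n - 1..real n}\<close>, and the increments telescope. Starting at
  \<open>m \<ge> 2\<close> keeps these intervals away from the singularity at 0. The subtracted end
  term is kept because the induction needs it.\<close>

lemma sum_powr_tail_le:
  fixes s :: real
  assumes s: "1 < s" and m: "2 \<le> m" "m \<le> k"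
  shows "(\<Sum>n=m..<k. real n powr (- s)) \<le> (real (m - 1) powr (1 - s) - real (k - 1) powr (1 - s)) / (s - 1)"
  using m(2)
proof (induction k rule: dec_induct)
  case base
  then show ?case by simp
next
  case (step n)
  define F where "F = (\<lambda>x::real. - (x powr (1 - s)) / (s - 1))"
  have n: "1 < real n" using step m(1) by simp
  have der: "(F has_real_derivative x powr (- s)) (at x)" if "x > 0" for x
  proof -
    have "(F has_real_derivative - ((1 - s) * x powr (1 - s - 1)) / (s - 1)) (at x)"
      unfolding F_def by (intro DERIV_cdivide DERIV_minus has_real_derivative_powr that)
    moreover have "- ((1 - s) * x powr (1 - s - 1)) / (s - 1) = x powr (- s)"
      using s by (simp add: field_simps)
    ultimately show ?thesis by simp
  qed
  obtain z where z: "real n - 1 < z" "z < real n" "F (real n) - F (real n - 1) = (real n - (real n - 1)) * z powr (- s)"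
    using MVT2[of "real n - 1" "real n" F "\<lambda>x. x powr (- s)"] der n by auto
  have "real n powr (- s) \<le> z powr (- s)"
    using z n s by (intro powr_mono2') auto
  also have "\<dots> = F (real n) - F (real n - 1)" using z by simp
  also have "\<dots> = (real (n - 1) powr (1 - s) - real n powr (1 - s)) / (s - 1)"
    using n by (simp add: F_def diff_divide_distrib)
  finally have "(\<Sum>i=m..<Suc n. real i powr (- s))
      \<le> (real (m - 1) powr (1 - s) - real (n - 1) powr (1 - s)) / (s - 1)
        + (real (n - 1) powr (1 - s) - real n powr (1 - s)) / (s - 1)"
    unfolding sum.op_ivl_Suc using step.IH step.hyps by (simp del: of_nat_diff)
  also have "\<dots> = (real (m - 1) powr (1 - s) - real (Suc n - 1) powr (1 - s)) / (s - 1)"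
    by (simp add: diff_divide_distrib)
  finally show ?case .
qed

text \<open>The tail bound already yields \<open>1 / (s - 1)\<close>. The weaker
  \<open>s / (s - 1)\<close> is the shape of the last factor of \<open>c2\<close>, with
  \<open>s\<close> equal to \<open>\<alpha> + 2 - \<mu> - \<beta>\<close>.\<close>

lemma sum_powr_le:
  fixes s :: real
  assumes s: "1 < s" and m: "2 \<le> m" "m \<le> k"
  shows "(\<Sum>n=m..<k. real n powr (- s)) \<le> s / (s - 1)"
proof -
  have "real (m - 1) powr (1 - s) \<le> 1 powr (1 - s)"
    using m s by (intro powr_mono2') auto
  moreover have "0 \<le> real (k - 1) powr (1 - s)" by simp
  ultimately have "real (m - 1) powr (1 - s) - real (k - 1) powr (1 - s) \<le> s"
    using s by (simp del: powr_ge_zero)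
  then have "(real (m - 1) powr (1 - s) - real (k - 1) powr (1 - s)) / (s - 1) \<le> s / (s - 1)"
    using s by (intro divide_right_mono) auto
  then show ?thesis using sum_powr_tail_le[OF assms] by simp
qed

lemma integral_eq_sum_unit_intervals:
  fixes f :: "real \<Rightarrow> 'a::banach"
  assumes "m \<le> k" "f integrable_on {real m..real k}"
  shows "integral {real m..real k} f = (\<Sum>n=m..<k. integral {real n..real n + 1} f)"
  using assms
proof (induction k rule: dec_induct)
  case base
  then show ?case by simp
next
  case (step n)
  have "f integrable_on {real m..real n}"
    using step.prems by (rule integrable_subinterval_real) auto
  with step.IH have "integral {real m..real n} f = (\<Sum>n=m..<n. integral {real n..real n + 1} f)" .
  moreover have "integral {real m..real n} f + integral {real n..real (Suc n)} f = integral {real m..real (Suc n)} f"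
    using step by (intro Henstock_Kurzweil_Integration.integral_combine) auto
  ultimately show ?case using step.hyps by (simp add: add.commute)
qed

section \<open>The oscillatory integral on a half-line\<close>

text \<open>The estimate concerns \<open>{0..real k}\<close> with a bound independent of
  \<open>k\<close>, so that the limit can be taken afterwards. The amplitude and the concave phase
  are abstract, so that the negative half-line is covered by the reflected data. The integrand is
  prescribed for \<open>p > 0\<close> only, its value at 0 being arbitrary.\<close>

lemma half_line_bound:
  fixes v v1 q :: "real \<Rightarrow> complex" and \<phi> \<phi>1 \<phi>2 :: "real \<Rightarrow> real" and \<alpha> \<beta> \<mu> :: real and N k :: nat
  defines "s \<equiv> \<alpha> + 2 - \<mu> - \<beta>"
  assumes N: "2 \<le> N" "N \<le> k" and \<mu>: "0 < \<mu>" "\<mu> \<le> 1" and t: "0 < t" and m: "0 < m" and \<kappa>: "0 < \<kappa>"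
    and \<beta>: "1 < \<beta>" and \<alpha>: "\<mu> + \<beta> - 1 < \<alpha>"
    and v: "\<And>p. (v has_vector_derivative v1 p) (at p)"
    and v1: "\<And>c d. (\<lambda>p. norm (v1 p)) integrable_on {c..d}"
    and \<phi>: "\<And>p. (\<phi> has_real_derivative \<phi>1 p) (at p)"
    and \<phi>1: "\<And>p. (\<phi>1 has_real_derivative \<phi>2 p) (at p)"
    and \<phi>2: "\<And>p. \<phi>2 p \<le> 0"
    and near: "(\<forall>p\<in>{0..real N}. t * m \<le> \<phi>1 p) \<or> (\<forall>p\<in>{0..real N}. \<phi>1 p \<le> - (t * m))"
    and far: "(\<forall>p\<ge>real N. t * (\<kappa> * p powr (1 - \<beta>)) \<le> \<phi>1 p) \<or>
              (\<forall>p\<ge>real N. \<phi>1 p \<le> - (t * (\<kappa> * p powr (1 - \<beta>))))"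
    and L: "\<And>p. p \<in> {0..real N} \<Longrightarrow> norm (v p) \<le> L"
    and V: "integral {0..real N} (\<lambda>p. norm (v1 p)) \<le> V"
    and M: "\<And>p. real N \<le> p \<Longrightarrow> norm (v p) \<le> M * p powr (- \<alpha>)"
    and M': "\<And>n. N \<le> n \<Longrightarrow> integral {real n..real n + 1} (\<lambda>p. norm (v1 p)) \<le> M' * real n powr (- \<alpha>)"
    and M0: "0 \<le> M" "0 \<le> M'"
    and q: "\<And>p. p > 0 \<Longrightarrow> q p = complex_of_real (p powr (\<mu> - 1)) * v p * cis (\<phi> p)"
    and q_int: "q integrable_on {0..real k}"
  shows "norm (integral {0..real k} q) \<le>
    (1 / \<mu> * L + (4 * L + V) / m) * t powr (- \<mu>)
    + 2 powr (\<beta> - 1) * (4 * M + M') / \<kappa> * (s / (s - 1)) * t powr (- 1)"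
proof -
  have s: "1 < s" using \<alpha> by (simp add: s_def)
  have \<alpha>0: "0 < \<alpha>" using \<alpha> \<beta> \<mu> by simp
  \<comment> \<open>Cutting at \<open>1 / t\<close> balances two costs: direct integration of the
    weight up to there gives \<open>t powr (- \<mu>)\<close> over \<open>\<mu>\<close>, and beyond
    it the weight is at most \<open>t powr (1 - \<mu>)\<close>, which the factor
    \<open>1 / t\<close> from integration by parts brings to the same power. The minimum keeps the
    first piece inside the range of the bound \<open>L\<close>.\<close>
  define \<delta> where "\<delta> = min (1 / t) (real N)"
  have \<delta>: "0 < \<delta>" "\<delta> \<le> real N" "\<delta> \<le> 1 / t" using t N by (auto simp: \<delta>_def)
  have L0: "0 \<le> L" using order_trans[OF norm_ge_zero L[of 0]] by simp
  have V_le: "integral {c..d} (\<lambda>p. norm (v1 p)) \<le> V" if "0 \<le> c" "d \<le> real N" for c d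
    using integral_subset_le[of "{c..d}" "{0..real N}" "\<lambda>p. norm (v1 p)"] V v1 that by auto
  have V0: "0 \<le> V" using V_le[of 0 0] by simp
  have q_int': "q integrable_on {c..d}" if "0 \<le> c" "d \<le> real k" for c d
    using q_int that by (intro integrable_subinterval_real[OF q_int]) auto
  have q_cong: "integral {c..d} q = integral {c..d} (\<lambda>p. complex_of_real (p powr (\<mu> - 1)) * v p * cis (\<phi> p))"
    if "0 < c" for c d
    using that by (intro Henstock_Kurzweil_Integration.integral_cong q) auto
  have head: "norm (integral {0..\<delta>} q) \<le> 1 / \<mu> * L * t powr (- \<mu>)"
  proof -
    have maj: "((\<lambda>p. L * p powr (\<mu> - 1)) has_integral L * (\<delta> powr \<mu> / \<mu>)) {0..\<delta>}"
      using has_integral_mult_right[OF has_integral_powr_from_0[of "\<mu> - 1" \<delta>], of L] \<mu> \<delta> by simp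
    \<comment> \<open>The majorant vanishes at 0, since \<open>0 powr (\<mu> - 1) = 0\<close>, while
      \<open>q 0\<close> is unknown. Changing the integrand at this one point restores the pointwise
      bound without changing the integral.\<close>
    have q0: "((\<lambda>p. if p = 0 then 0 else q p) has_integral integral {0..\<delta>} q) {0..\<delta>}"
      by (rule has_integral_spike_finite[of "{0}" _ _ q])
        (use q_int'[of 0 \<delta>] \<delta> N in \<open>auto intro: integrable_integral\<close>)
    have "norm (integral {0..\<delta>} (\<lambda>p. if p = 0 then 0 else q p)) \<le> integral {0..\<delta>} (\<lambda>p. L * p powr (\<mu> - 1))"
    proof (rule integral_norm_bound_integral)
      fix p assume p: "p \<in> {0..\<delta>}"
      show "norm (if p = 0 then 0 else q p) \<le> L * p powr (\<mu> - 1)"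
        using p \<delta> L[of p] L0 q[of p] by (auto simp: norm_mult intro!: mult_right_mono)
    qed (use maj q0 in auto)
    then have "norm (integral {0..\<delta>} q) \<le> L * (\<delta> powr \<mu> / \<mu>)"
      by (simp only: integral_unique[OF maj] integral_unique[OF q0])
    also have "\<dots> \<le> L * ((1 / t) powr \<mu> / \<mu>)"
      using L0 \<mu> \<delta> by (intro mult_left_mono divide_right_mono powr_mono2) auto
    also have "\<dots> = 1 / \<mu> * L * t powr (- \<mu>)"
      using t by (simp add: powr_divide powr_minus field_simps)
    finally show ?thesis .
  qed
  have middle: "norm (integral {\<delta>..real N} q) \<le> (4 * L + V) / m * t powr (- \<mu>)"
  proof (cases "1 / t \<le> real N")
    case True
    then have \<delta>_eq: "\<delta> = 1 / t" by (simp add: \<delta>_def)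
    have "norm (integral {\<delta>..real N} (\<lambda>p. complex_of_real (p powr (\<mu> - 1)) * v p * cis (\<phi> p)))
      \<le> (4 * L + V) * \<delta> powr (\<mu> - 1) / (t * m)"
      by (rule weighted_nonstationary_phase_bound[OF \<delta>(1,2) \<mu>(2) v v1 _ \<phi> \<phi>1 \<phi>2])
        (use t m near \<delta> L V_le[of \<delta> N] in auto)
    also have "\<delta> powr (\<mu> - 1) / t = t powr (- \<mu>)"
      using t by (simp add: \<delta>_eq powr_divide powr_diff powr_minus field_simps)
    then have "(4 * L + V) * \<delta> powr (\<mu> - 1) / (t * m) = (4 * L + V) / m * t powr (- \<mu>)"
      by (metis divide_divide_eq_left mult.commute times_divide_eq_left times_divide_eq_right)
    finally show ?thesis using q_cong[OF \<delta>(1)] by simp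
  next
    case False
    then have "\<delta> = real N" by (simp add: \<delta>_def)
    then show ?thesis using L0 V0 m by simp
  qed
  have unit: "norm (integral {real n..real n + 1} q)
      \<le> 2 powr (\<beta> - 1) * (4 * M + M') / \<kappa> * t powr (- 1) * real n powr (- s)" if n: "N \<le> n" for n
  proof -
    have n2: "2 \<le> real n" using n N by simp
    \<comment> \<open>The lower bound for the phase derivative decreases in \<open>p\<close> because
      \<open>1 - \<beta> < 0\<close>, so its value at the right end serves the whole unit
      interval.\<close>
    define K where "K = t * (\<kappa> * (real n + 1) powr (1 - \<beta>))"
    have K: "0 < K" using t \<kappa> by (simp add: K_def)
    have K_le: "K \<le> t * (\<kappa> * p powr (1 - \<beta>))" if "p \<in> {real n..real n + 1}" for p
      unfolding K_def using that t \<kappa> \<beta> n2 by (intro mult_left_mono powr_mono2') auto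
    have K_sign: "(\<forall>p\<in>{real n..real n + 1}. K \<le> \<phi>1 p) \<or> (\<forall>p\<in>{real n..real n + 1}. \<phi>1 p \<le> - K)"
      using far
    proof
      assume *: "\<forall>p\<ge>real N. t * (\<kappa> * p powr (1 - \<beta>)) \<le> \<phi>1 p"
      have "K \<le> \<phi>1 p" if "p \<in> {real n..real n + 1}" for p
        using K_le[OF that] *[rule_format, of p] that n by simp
      then show ?thesis by blast
    next
      assume *: "\<forall>p\<ge>real N. \<phi>1 p \<le> - (t * (\<kappa> * p powr (1 - \<beta>)))"
      have "\<phi>1 p \<le> - K" if "p \<in> {real n..real n + 1}" for p
        using K_le[OF that] *[rule_format, of p] that n by simp
      then show ?thesis by blast
    qed
    have v_le: "norm (v p) \<le> M * real n powr (- \<alpha>)" if "p \<in> {real n..real n + 1}" for p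
    proof -
      have "norm (v p) \<le> M * p powr (- \<alpha>)" using M[of p] that n by simp
      also have "\<dots> \<le> M * real n powr (- \<alpha>)"
        using that n2 \<alpha>0 M0 by (intro mult_left_mono powr_mono2') auto
      finally show ?thesis .
    qed
    have "norm (integral {real n..real n + 1} (\<lambda>p. complex_of_real (p powr (\<mu> - 1)) * v p * cis (\<phi> p)))
      \<le> (4 * (M * real n powr (- \<alpha>)) + M' * real n powr (- \<alpha>)) * real n powr (\<mu> - 1) / K"
      by (rule weighted_nonstationary_phase_bound[OF _ _ \<mu>(2) v v1 M'[OF n] \<phi> \<phi>1 \<phi>2 K K_sign v_le])
        (use n2 in auto)
    also have "\<dots> = (4 * M + M') / \<kappa> * t powr (- 1) * (real n + 1) powr (\<beta> - 1)
        * (real n powr (- \<alpha>) * real n powr (\<mu> - 1))"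
    proof -
      have "1 / (real n + 1) powr (1 - \<beta>) = (real n + 1) powr (\<beta> - 1)"
        using powr_minus_divide[of "real n + 1" "1 - \<beta>"] by simp
      moreover have "1 / K = 1 / \<kappa> * t powr (- 1) * (1 / (real n + 1) powr (1 - \<beta>))"
        using t by (simp add: K_def powr_minus divide_inverse)
      ultimately have "1 / K = 1 / \<kappa> * t powr (- 1) * (real n + 1) powr (\<beta> - 1)"
        by simp
      then have *: "X / K = X * (1 / \<kappa> * t powr (- 1) * (real n + 1) powr (\<beta> - 1))" for X
        by (metis mult.right_neutral times_divide_eq_right)
      show ?thesis unfolding * by (simp add: algebra_simps add_divide_distrib)
    qed
    \<comment> \<open>\<open>real n + 1 \<le> 2 * real n\<close> trades the right end for the left
      one at the price of \<open>2 powr (\<beta> - 1)\<close>; all powers of \<open>real n\<close>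
      then combine to the exponent \<open>- s\<close>.\<close>
    also have "\<dots> \<le> (4 * M + M') / \<kappa> * t powr (- 1) * (2 powr (\<beta> - 1) * real n powr (\<beta> - 1))
        * (real n powr (- \<alpha>) * real n powr (\<mu> - 1))"
    proof -
      have "(real n + 1) powr (\<beta> - 1) \<le> (2 * real n) powr (\<beta> - 1)"
        using n2 \<beta> by (intro powr_mono2) auto
      then have "(real n + 1) powr (\<beta> - 1) \<le> 2 powr (\<beta> - 1) * real n powr (\<beta> - 1)"
        by (simp add: powr_mult)
      then show ?thesis using M0 \<kappa> by (intro mult_right_mono mult_left_mono) auto
    qed
    also have "\<dots> = 2 powr (\<beta> - 1) * (4 * M + M') / \<kappa> * t powr (- 1)
        * (real n powr (\<beta> - 1) * (real n powr (- \<alpha>) * real n powr (\<mu> - 1)))"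
      by simp
    also have "real n powr (\<beta> - 1) * (real n powr (- \<alpha>) * real n powr (\<mu> - 1)) = real n powr (- s)"
      using n2 by (simp add: powr_add[symmetric] s_def algebra_simps)
    finally show ?thesis using q_cong[of "real n" "real n + 1"] n2 by simp
  qed
  have tail: "norm (integral {real N..real k} q)
      \<le> 2 powr (\<beta> - 1) * (4 * M + M') / \<kappa> * (s / (s - 1)) * t powr (- 1)"
  proof -
    have "norm (integral {real N..real k} q) = norm (\<Sum>n=N..<k. integral {real n..real n + 1} q)"
      using integral_eq_sum_unit_intervals[OF N(2) q_int'[of N k]] by simp
    also have "\<dots> \<le> (\<Sum>n=N..<k. 2 powr (\<beta> - 1) * (4 * M + M') / \<kappa> * t powr (- 1) * real n powr (- s))"
      by (rule sum_norm_le) (use unit in auto)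
    also have "\<dots> = 2 powr (\<beta> - 1) * (4 * M + M') / \<kappa> * t powr (- 1) * (\<Sum>n=N..<k. real n powr (- s))"
      by (simp add: sum_distrib_left)
    also have "\<dots> \<le> 2 powr (\<beta> - 1) * (4 * M + M') / \<kappa> * t powr (- 1) * (s / (s - 1))"
      using sum_powr_le[OF s N] M0 \<kappa> by (intro mult_left_mono) auto
    finally show ?thesis by (simp add: algebra_simps)
  qed
  have "integral {0..real k} q = integral {0..\<delta>} q + integral {\<delta>..real k} q"
    using \<delta> N q_int by (intro Henstock_Kurzweil_Integration.integral_combine[symmetric]) auto
  also have "integral {\<delta>..real k} q = integral {\<delta>..real N} q + integral {real N..real k} q"
    using \<delta> N q_int'[of \<delta> k] by (intro Henstock_Kurzweil_Integration.integral_combine[symmetric]) auto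
  finally have "norm (integral {0..real k} q)
      \<le> norm (integral {0..\<delta>} q) + (norm (integral {\<delta>..real N} q) + norm (integral {real N..real k} q))"
    by (metis norm_triangle_mono norm_triangle_ineq order_refl)
  then show ?thesis using head middle tail by (simp add: algebra_simps)
qed

section \<open>Passage to the whole line, and pointwise bounds from the essential supremum\<close>

text \<open>The integral over the line is approximated by integrals over large symmetric intervals,
  so a bound uniform in \<open>k\<close> survives the limit. The threshold \<open>k0\<close> admits
  estimates that hold only for large \<open>k\<close>.\<close>

lemma norm_has_integral_UNIV_le:
  fixes f :: "real \<Rightarrow> 'a::banach"
  assumes f: "(f has_integral I) UNIV"
    and B: "\<And>k::nat. k0 \<le> k \<Longrightarrow> norm (integral {- real k..real k} f) \<le> B"
  shows "norm I \<le> B"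
proof (rule field_le_epsilon)
  fix e :: real assume e: "0 < e"
  have "\<forall>e>0. \<exists>r>0. \<forall>a b. ball 0 r \<subseteq> cbox a b \<longrightarrow> norm (integral (cbox a b) f - I) < e"
    using f has_integral_alt'[of f I UNIV] by simp
  then obtain r where r: "\<And>a b. ball 0 r \<subseteq> cbox a b \<Longrightarrow> norm (integral (cbox a b) f - I) < e"
    using e by blast
  obtain k where k: "k \<ge> k0" "real k \<ge> r"
    by (metis linear nle_le of_nat_le_iff order_trans real_arch_simple)
  have "ball 0 r \<subseteq> cbox (- real k) (real k)"
    using k by (auto simp: dist_real_def)
  from r[OF this] have "norm (integral {- real k..real k} f - I) < e" by simp
  then have "norm I \<le> norm (integral {- real k..real k} f) + e"
    using norm_triangle_sub[of I "integral {- real k..real k} f"] by (simp add: norm_minus_commute)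
  then show "norm I \<le> B + e" using B[OF k(1)] by simp
qed

text \<open>By continuity the points where the bound holds form a closed set. It contains almost
  every point of the open interval, hence the whole interval, hence its closure with both end
  points.\<close>

lemma norm_le_Linf_norm_on:
  fixes v :: "real \<Rightarrow> complex"
  assumes cont: "continuous_on UNIV v" and bdd: "bounded (range v)" and cd: "c < d" and p: "p \<in> {c..d}"
  shows "norm (v p) \<le> Linf_norm_on {c<..<d} v"
proof -
  define S where "S = {c<..<d}"
  define e where "e = esssup (restrict_space lborel S) (\<lambda>x. ereal (norm (v x)))"
  have [measurable]: "v \<in> borel_measurable borel"
    using cont by (rule borel_measurable_continuous_onI)
  have meas: "(\<lambda>x. ereal (norm (v x))) \<in> borel_measurable (restrict_space lborel S)"
    by (intro measurable_restrict_space1) simp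
  obtain B where B: "\<And>x. norm (v x) \<le> B" using bdd by (auto simp: bounded_iff)
  \<comment> \<open>On a space of measure 0 the essential supremum would be minus infinity; positive
    measure gives \<open>0 \<le> e\<close>. With the upper bound this makes \<open>e\<close> finite,
    so that \<open>real_of_ereal\<close> loses nothing.\<close>
  have pos: "emeasure (restrict_space lborel S) (space (restrict_space lborel S)) \<noteq> 0"
    using cd by (simp add: S_def space_restrict_space emeasure_restrict_space)
  have "e \<le> ereal B"
    unfolding e_def using B by (intro esssup_I meas) auto
  moreover have "0 \<le> e"
    unfolding e_def using esssup_const[OF pos, of "0::ereal"]
      esssup_AE_mono[of "\<lambda>x. 0::ereal" "restrict_space lborel S" "\<lambda>x. ereal (norm (v x))"] by simp
  ultimately have e: "e = ereal (Linf_norm_on S v)"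
    unfolding Linf_norm_on_def e_def[symmetric] by (cases e) auto
  have "AE x in restrict_space lborel S. ereal (norm (v x)) \<le> e"
    unfolding e_def by (rule esssup_AE)
  then have "AE x in lborel. x \<in> S \<longrightarrow> norm (v x) \<le> Linf_norm_on S v"
    by (subst (asm) AE_restrict_space_iff) (auto simp: e S_def)
  then have ae: "AE x\<in>S in lebesgue. x \<in> {x. norm (v x) \<le> Linf_norm_on S v}"
    by (simp add: AE_completion)
  have "closed {x. norm (v x) \<le> Linf_norm_on S v}"
    using cont by (intro closed_Collect_le continuous_intros)
  then have "S \<subseteq> {x. norm (v x) \<le> Linf_norm_on S v}"
    using mem_closed_if_AE_lebesgue_open[OF _ _ ae] by (auto simp: S_def)
  then have "closure S \<subseteq> {x. norm (v x) \<le> Linf_norm_on S v}"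
    using \<open>closed _\<close> by (rule closure_minimal)
  then show ?thesis using p cd by (auto simp: S_def)
qed

section \<open>Limits of a monotone function and distance to them\<close>

text \<open>Adding the integral of \<open>C * x powr (- \<beta>)\<close> from \<open>p\<close> to
  infinity to \<open>F p\<close> gives a function \<open>G\<close> that is nonincreasing beyond
  \<open>R\<close>. Thus \<open>F\<close> is bounded above by \<open>G R\<close>, and being strictly
  increasing it converges to its supremum without attaining it.\<close>

lemma tendsto_at_top_of_derivative_decay:
  fixes F F1 :: "real \<Rightarrow> real"
  assumes F: "\<And>p. (F has_real_derivative F1 p) (at p)" and pos: "\<And>p. 0 < F1 p"
    and R: "0 < R" and \<beta>: "1 < \<beta>"
    and decay: "\<And>p. R \<le> p \<Longrightarrow> F1 p \<le> C * p powr (- \<beta>)"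
  obtains l where "(F \<longlongrightarrow> l) at_top" "\<And>p. F p < l"
proof -
  have mono: "F p < F p'" if "p < p'" for p p'
    using DERIV_pos_imp_increasing[OF that] F pos by blast
  define G where "G = (\<lambda>p. F p + C / (\<beta> - 1) * p powr (1 - \<beta>))"
  have C: "0 \<le> C"
    using order.strict_trans2[OF pos decay[of R]] R by (simp add: zero_less_mult_iff)
  have G_mono: "G p \<le> G R" if "R \<le> p" for p
  proof (rule DERIV_nonpos_imp_nonincreasing[OF that])
    fix x assume x: "R \<le> x" "x \<le> p"
    have "(G has_real_derivative F1 x + C / (\<beta> - 1) * ((1 - \<beta>) * x powr (1 - \<beta> - 1))) (at x)"
      unfolding G_def using x R by (intro DERIV_add DERIV_cmult F has_real_derivative_powr) auto
    moreover have "C / (\<beta> - 1) * ((1 - \<beta>) * x powr (1 - \<beta> - 1)) = - (C * x powr (- \<beta>))"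
      using \<beta> by (simp add: field_simps)
    ultimately show "\<exists>y. (G has_real_derivative y) (at x) \<and> y \<le> 0"
      using decay[OF x(1)] by force
  qed
  have F_le: "F p \<le> G R" for p
  proof -
    have "F p \<le> F (max p R)" using mono[of p "max p R"] by (cases "R \<le> p") (auto simp: max_def)
    also have "\<dots> \<le> G (max p R)" unfolding G_def using C \<beta> by simp
    also have "\<dots> \<le> G R" by (rule G_mono) simp
    finally show ?thesis .
  qed
  then have bdd: "bdd_above (range F)" by (auto simp: bdd_above_def)
  show ?thesis
  proof (rule that)
    show lt: "F p < (SUP p. F p)" for p
      using mono[of p "p + 1"] cSUP_upper[OF UNIV_I bdd, of "p + 1"] by simp
    show "(F \<longlongrightarrow> (SUP p. F p)) at_top"
    proof (rule order_tendstoI)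
      fix y assume "y < (SUP p. F p)"
      then obtain p0 where p0: "y < F p0"
        using less_cSUP_iff[OF _ bdd] by auto
      show "eventually (\<lambda>p. y < F p) at_top"
        using eventually_gt_at_top[of p0] by eventually_elim (use mono p0 in \<open>force intro: less_trans\<close>)
    qed (use lt in \<open>auto intro: always_eventually less_trans\<close>)
  qed
qed

text \<open>With a lower bound on the derivative the same corrected function \<open>G\<close> is
  nondecreasing. Since the correction tends to 0, \<open>G\<close> tends to \<open>l\<close> and
  therefore stays below it.\<close>

lemma limit_minus_ge:
  fixes F F1 :: "real \<Rightarrow> real"
  assumes F: "\<And>p. (F has_real_derivative F1 p) (at p)"
    and R: "0 < R" and \<beta>: "1 < \<beta>"
    and decay: "\<And>p. R \<le> p \<Longrightarrow> C * p powr (- \<beta>) \<le> F1 p"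
    and lim: "(F \<longlongrightarrow> l) at_top" and p: "R \<le> p"
  shows "C / (\<beta> - 1) * p powr (1 - \<beta>) \<le> l - F p"
proof -
  define G where "G = (\<lambda>p. F p + C / (\<beta> - 1) * p powr (1 - \<beta>))"
  have G_mono: "G p \<le> G p'" if "p \<le> p'" for p'
  proof (rule DERIV_nonneg_imp_nondecreasing[OF that])
    fix x assume x: "p \<le> x" "x \<le> p'"
    have "(G has_real_derivative F1 x + C / (\<beta> - 1) * ((1 - \<beta>) * x powr (1 - \<beta> - 1))) (at x)"
      unfolding G_def using x R p by (intro DERIV_add DERIV_cmult F has_real_derivative_powr) auto
    moreover have "C / (\<beta> - 1) * ((1 - \<beta>) * x powr (1 - \<beta> - 1)) = - (C * x powr (- \<beta>))"
      using \<beta> by (simp add: field_simps)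
    ultimately show "\<exists>y. (G has_real_derivative y) (at x) \<and> 0 \<le> y"
      using decay[of x] x p by force
  qed
  have "((\<lambda>p. p powr (1 - \<beta>)) \<longlongrightarrow> 0) at_top"
    using \<beta> by (intro tendsto_neg_powr filterlim_ident) auto
  then have "(G \<longlongrightarrow> l + C / (\<beta> - 1) * 0) at_top"
    unfolding G_def by (intro tendsto_intros lim)
  moreover have "eventually (\<lambda>p'. G p \<le> G p') at_top"
    using eventually_ge_at_top[of p] by eventually_elim (rule G_mono)
  ultimately have "G p \<le> l"
    using tendsto_lowerbound[of G l at_top "G p"] by simp
  then show ?thesis by (simp add: G_def)
qed

section \<open>Application to the solution outside the cone\<close>

theorem theorem2p12:
  fixes f :: "real \<Rightarrow> real"
    and R \<beta>\<^sub>m \<beta>\<^sub>p c\<^sub>m c\<^sub>p \<mu> \<alpha> r M M' a b N :: real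
    and u\<^sub>0 :: "(real \<Rightarrow> complex) \<Rightarrow> complex"
    and Fu\<^sub>0 v :: "real \<Rightarrow> complex"
    and u :: "real \<Rightarrow> real \<Rightarrow> complex"
  assumes f_smooth: "smooth_poly_growth f"
    and f_convex: "\<And>p. deriv (deriv f) p > 0"
    and R: "R > 0"
    and \<beta>: "\<beta>\<^sub>m \<ge> \<beta>\<^sub>p" "\<beta>\<^sub>p > 1"
    and c: "c\<^sub>p > 0" "c\<^sub>m > 0"
    and f_decay: "\<And>p. \<bar>p\<bar> \<ge> R \<Longrightarrow>
          c\<^sub>m * \<bar>p\<bar> powr (- \<beta>\<^sub>m) \<le> deriv (deriv f) p \<and>
          deriv (deriv f) p \<le> c\<^sub>p * \<bar>p\<bar> powr (- \<beta>\<^sub>p)"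
    and \<mu>: "0 < \<mu>" "\<mu> \<le> 1"
    and \<alpha>: "\<alpha> > \<mu> + \<beta>\<^sub>m - 1"
    and r: "0 \<le> r" "r \<le> R"
    and u0_tempered: "tempered_distribution u\<^sub>0"
    and Fu0_function: "is_regular (fourier_distr u\<^sub>0) Fu\<^sub>0"
    and v_bounded: "bounded (range v)"
    and v_diff: "\<And>p. v differentiable (at p)"
    and v_nonzero: "\<mu> \<noteq> 1 \<Longrightarrow> v 0 \<noteq> 0"
    and Fu0_eq: "\<And>p. p \<noteq> 0 \<Longrightarrow> Fu\<^sub>0 p = complex_of_real (\<bar>p\<bar> powr (\<mu> - 1)) * v p"
    and M: "M \<ge> 0" "\<And>p. norm (v p) \<le> M * (1 + p\<^sup>2) powr (- (\<alpha> / 2))"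
    and v'_L1_loc: "L1_loc (D1 v)"
    \<comment> \<open>For \<open>n = 0\<close> the bound \<open>M' \<bar>n\<bar>\<^sup>-\<^sup>\<alpha>\<close> is infinite, whereas \<open>0 powr (- \<alpha>) = 0\<close>.\<close>
    and M': "M' \<ge> 0"
          "\<And>n::int. n \<noteq> 0 \<Longrightarrow> \<bar>real_of_int n\<bar> \<ge> r \<Longrightarrow>
             L1_norm_on {real_of_int n<..<real_of_int n + 1} (D1 v)
               \<le> M' * \<bar>real_of_int n\<bar> powr (- \<alpha>)"
    and u: "\<And>t x. t > 0 \<Longrightarrow> u t x = solution f Fu\<^sub>0 t x"
    and a: "a = Lim at_bot (deriv f)"
    and b: "b = Lim at_top (deriv f)"
    and N: "N = real_of_int (\<lceil>R\<rceil> + 1)"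
  shows "(deriv f \<longlongrightarrow> a) at_bot \<and> (deriv f \<longlongrightarrow> b) at_top \<and> a < b \<and>
         m_neg f a b N > 0 \<and> m_pos f a b N > 0 \<and>
         (\<forall>(t, x)\<in>cone_compl a b.
            norm (u t x) \<le> c1 f a b N \<mu> v * t powr (- \<mu>)
                             + c2 c\<^sub>m \<beta>\<^sub>m \<mu> \<alpha> M M' * t powr (- 1))"
proof -
  define S where "S = (\<alpha> + 2 - \<mu> - \<beta>\<^sub>m) / (\<alpha> + 1 - \<mu> - \<beta>\<^sub>m)"
  define \<kappa> where "\<kappa> = c\<^sub>m / (\<beta>\<^sub>m - 1)"
  have \<beta>1: "1 < \<beta>\<^sub>m" using \<beta> by simp
  have \<alpha>0: "0 < \<alpha>" using \<alpha> \<mu> \<beta>1 by simp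
  have \<kappa>: "0 < \<kappa>" using c \<beta>1 by (simp add: \<kappa>_def)
  have S: "0 \<le> S" using \<alpha> by (simp add: S_def)
  \<comment> \<open>\<open>R > 0\<close> makes the ceiling at least 1, so the cut \<open>N\<close>
    is an integer not below 2, as the sum over unit intervals requires.\<close>
  obtain n0 :: nat where n0: "N = real n0" "2 \<le> n0"
  proof
    have "1 \<le> \<lceil>R\<rceil>" using R by (simp add: one_le_ceiling)
    then have "2 \<le> \<lceil>R\<rceil> + 1" by linarith
    then show "N = real (nat (\<lceil>R\<rceil> + 1))" "2 \<le> nat (\<lceil>R\<rceil> + 1)"
      by (simp_all add: N le_nat_iff del: ceiling_add_one)
  qed
  have RN: "R \<le> real n0" using N n0(1) le_of_int_ceiling[of R] unfolding of_int_add of_int_1 by linarith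

  \<comment> \<open>The derivative of the symbol and its limits\<close>
  define f1 where "f1 = deriv f"
  define f2 where "f2 = deriv (deriv f)"
  have f1: "(f has_real_derivative f1 p) (at p)" for p
    using f_smooth[unfolded smooth_poly_growth_def, THEN conjunct1, rule_format, of 0 p]
    by (simp add: f1_def DERIV_deriv_iff_field_differentiable)
  have f2: "(f1 has_real_derivative f2 p) (at p)" for p
    using f_smooth[unfolded smooth_poly_growth_def, THEN conjunct1, rule_format, of 1 p]
    by (simp add: f1_def f2_def DERIV_deriv_iff_field_differentiable)
  have f2_pos: "0 < f2 p" for p using f_convex by (simp add: f2_def)
  have f1_mono: "f1 p \<le> f1 p'" if "p \<le> p'" for p p'
    using DERIV_nonneg_imp_nondecreasing[OF that] f2 f2_pos less_imp_le by metis
  \<comment> \<open>The odd reflection of \<open>f1\<close> is again increasing, with derivative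
    \<open>f2 (- p)\<close>, so the behaviour at minus infinity follows from the lemmas for plus
    infinity.\<close>
  have f1_reflect: "((\<lambda>p. - f1 (- p)) has_real_derivative f2 (- p)) (at p)" for p
    using DERIV_minus[OF DERIV_chain2[OF f2 DERIV_minus[OF DERIV_ident]]] by simp
  have decay: "c\<^sub>m * p powr (- \<beta>\<^sub>m) \<le> f2 p" "f2 p \<le> c\<^sub>p * p powr (- \<beta>\<^sub>p)"
      "c\<^sub>m * p powr (- \<beta>\<^sub>m) \<le> f2 (- p)" "f2 (- p) \<le> c\<^sub>p * p powr (- \<beta>\<^sub>p)" if "R \<le> p" for p
    using f_decay[of p] f_decay[of "- p"] that R by (auto simp: f2_def)
  obtain l where l: "(f1 \<longlongrightarrow> l) at_top" "\<And>p. f1 p < l"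
    using tendsto_at_top_of_derivative_decay[OF f2 f2_pos R \<beta>(2) decay(2)] by blast
  obtain l' where l': "((\<lambda>p. - f1 (- p)) \<longlongrightarrow> l') at_top" "\<And>p. - f1 (- p) < l'"
    using tendsto_at_top_of_derivative_decay[OF f1_reflect f2_pos R \<beta>(2) decay(4)] by blast
  have "((\<lambda>p. f1 (- p)) \<longlongrightarrow> - l') at_top"
    using tendsto_minus[OF l'(1)] by simp
  then have l'_bot: "(f1 \<longlongrightarrow> - l') at_bot"
    by (simp add: filterlim_at_bot_mirror)
  \<comment> \<open>\<open>Lim\<close> is a choice operator; it is the limit only now that
    convergence is known.\<close>
  have b_eq: "b = l" using tendsto_Lim[OF _ l(1)] by (simp add: b f1_def)
  have a_eq: "a = - l'" using tendsto_Lim[OF _ l'_bot] by (simp add: a f1_def)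
  have f1_less: "f1 p < b" and f1_greater: "a < f1 p" for p
    using l(2)[of p] l'(2)[of "- p"] by (auto simp: b_eq a_eq)
  have gap: "\<kappa> * p powr (1 - \<beta>\<^sub>m) \<le> b - f1 p" "\<kappa> * p powr (1 - \<beta>\<^sub>m) \<le> f1 (- p) - a"
    if "real n0 \<le> p" for p
    using limit_minus_ge[OF f2 R \<beta>1 decay(1) l(1), of p] limit_minus_ge[OF f1_reflect R \<beta>1 decay(3) l'(1), of p]
      that RN by (simp_all add: \<kappa>_def a_eq b_eq)
  have m: "0 < m_neg f a b N" "0 < m_pos f a b N"
    using f1_less f1_greater by (simp_all add: m_neg_def m_pos_def f1_def)

  \<comment> \<open>The amplitude, its decay and its norms\<close>
  have v: "(v has_vector_derivative D1 v p) (at p)" for p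
    using v_diff by (simp add: D1_def vector_derivative_works[symmetric])
  have v_reflect: "((\<lambda>p. v (- p)) has_vector_derivative - D1 v (- p)) (at p)" for p
  proof -
    have "(uminus has_vector_derivative - 1) (at p)"
      using has_vector_derivative_minus[OF has_vector_derivative_id, of "at p"] .
    from vector_diff_chain_at[OF this v] show ?thesis by (simp add: o_def)
  qed
  have v_cont: "continuous_on UNIV v"
    by (intro continuous_at_imp_continuous_on ballI has_vector_derivative_continuous[OF v])
  have D1_int: "set_integrable lborel {p..p'} (\<lambda>x. norm (D1 v x))" for p p'
    using v'_L1_loc by (intro set_integrable_norm) (simp add: L1_loc_def)
  have v1: "(\<lambda>x. norm (D1 v x)) integrable_on {p..p'}" for p p'
    by (rule set_borel_integral_eq_integral[OF D1_int])
  then have v1_reflect: "(\<lambda>x. norm (- D1 v (- x))) integrable_on {p..p'}" for p p'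
    using Henstock_Kurzweil_Integration.integrable_reflect_real[of "\<lambda>x. norm (D1 v x)" "- p" "- p'"] by simp
  have L1_eq: "L1_norm_on {p<..<p'} (D1 v) = integral {p..p'} (\<lambda>x. norm (D1 v x))" for p p'
  proof -
    have "set_integrable lborel {p<..<p'} (\<lambda>x. norm (D1 v x))"
      by (rule set_integrable_subset[OF D1_int[of p p']]) auto
    then show ?thesis
      unfolding L1_norm_on_def
      by (simp add: set_borel_integral_eq_integral(2) integral_open_interval_real)
  qed
  have integral_reflect: "integral {p..p'} (\<lambda>x. norm (- D1 v (- x))) = integral {- p'..- p} (\<lambda>x. norm (D1 v x))" for p p'
    using Henstock_Kurzweil_Integration.integral_reflect_real[of p' p "\<lambda>x. norm (D1 v (- x))"] by simp
  have v_decay: "norm (v p) \<le> M * \<bar>p\<bar> powr (- \<alpha>)" if "p \<noteq> 0" for p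
  proof -
    have "norm (v p) \<le> M * (1 + p\<^sup>2) powr (- (\<alpha> / 2))" by (rule M)
    also have "\<dots> \<le> M * (p\<^sup>2) powr (- (\<alpha> / 2))"
      using that \<alpha>0 M(1) by (intro mult_left_mono powr_mono2') auto
    also have "(p\<^sup>2) powr (- (\<alpha> / 2)) = \<bar>p\<bar> powr (- \<alpha>)"
      using that powr_powr[of "\<bar>p\<bar>" 2 "- (\<alpha> / 2)"] by simp
    finally show ?thesis .
  qed
  have D1_decay: "integral {real n..real n + 1} (\<lambda>x. norm (D1 v x)) \<le> M' * real n powr (- \<alpha>)"
      "integral {- (real n + 1)..- real n} (\<lambda>x. norm (D1 v x)) \<le> M' * real n powr (- \<alpha>)" if n: "n0 \<le> n" for n
  proof -
    have n': "r \<le> real n" "2 \<le> real n" using r RN n n0(2) by linarith+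
    show "integral {real n..real n + 1} (\<lambda>x. norm (D1 v x)) \<le> M' * real n powr (- \<alpha>)"
      using M'(2)[of "int n"] n' by (simp add: L1_eq)
    \<comment> \<open>The interval with left end \<open>- (real n + 1)\<close> falls under the
      hypothesis for the integer \<open>- (int n + 1)\<close>; its bound, with
      \<open>real n + 1\<close> in place of \<open>real n\<close>, is the smaller one.\<close>
    have "integral {- (real n + 1)..- real n} (\<lambda>x. norm (D1 v x)) \<le> M' * (real n + 1) powr (- \<alpha>)"
      using M'(2)[of "- (int n + 1)"] n' by (simp add: L1_eq add.commute)
    also have "\<dots> \<le> M' * real n powr (- \<alpha>)"
      using n' \<alpha>0 M'(1) by (intro mult_left_mono powr_mono2') auto
    finally show "integral {- (real n + 1)..- real n} (\<lambda>x. norm (D1 v x)) \<le> M' * real n powr (- \<alpha>)" .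
  qed
  define Ln where "Ln = Linf_norm_on {- N<..<0} v"
  define Lp where "Lp = Linf_norm_on {0<..<N} v"
  define Vn where "Vn = L1_norm_on {- N<..<0} (D1 v)"
  define Vp where "Vp = L1_norm_on {0<..<N} (D1 v)"
  have Ln: "norm (v (- p)) \<le> Ln" and Lp: "norm (v p) \<le> Lp" if "p \<in> {0..real n0}" for p
    unfolding Ln_def Lp_def using that n0
    by (auto intro!: norm_le_Linf_norm_on[OF v_cont v_bounded])
  have Vn_eq: "integral {0..real n0} (\<lambda>x. norm (- D1 v (- x))) = Vn"
    and Vp_eq: "integral {0..real n0} (\<lambda>x. norm (D1 v x)) = Vp"
    unfolding integral_reflect by (simp_all add: Vn_def Vp_def L1_eq n0)
  have nonneg: "0 \<le> Ln" "0 \<le> Lp" "0 \<le> Vn" "0 \<le> Vp"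
    using order_trans[OF norm_ge_zero Ln[of 0]] order_trans[OF norm_ge_zero Lp[of 0]]
    by (simp_all add: Vn_def Vp_def L1_eq integral_nonneg v1)

  \<comment> \<open>The estimate at a fixed point outside the cone\<close>
  have bound: "norm (u t x) \<le> c1 f a b N \<mu> v * t powr (- \<mu>) + c2 c\<^sub>m \<beta>\<^sub>m \<mu> \<alpha> M M' * t powr (- 1)"
    if t: "0 < t" and x: "x < t * a \<or> t * b < x" for t x
  proof -
    define \<phi> where "\<phi> = (\<lambda>p. x * p - t * f p)"
    define q where "q = (\<lambda>p. Fu\<^sub>0 p * exp (- \<i> * complex_of_real t * complex_of_real (f p) + \<i> * complex_of_real x * complex_of_real p))"
    have \<phi>: "(\<phi> has_real_derivative x - t * f1 p) (at p)" for p
      unfolding \<phi>_def by (auto intro!: derivative_eq_intros f1)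
    have \<phi>1: "((\<lambda>p. x - t * f1 p) has_real_derivative - (t * f2 p)) (at p)" for p
      by (auto intro!: derivative_eq_intros f2)
    have \<phi>_reflect: "((\<lambda>p. \<phi> (- p)) has_real_derivative - (x - t * f1 (- p))) (at p)" for p
      using DERIV_chain2[OF \<phi> DERIV_minus[OF DERIV_ident]] by simp
    have \<phi>1_reflect: "((\<lambda>p. - (x - t * f1 (- p))) has_real_derivative - (t * f2 (- p))) (at p)" for p
      using DERIV_minus[OF DERIV_chain2[OF \<phi>1 DERIV_minus[OF DERIV_ident]]] by simp
    have \<phi>2: "- (t * f2 p) \<le> 0" for p
      using t f2_pos[of p] by simp
    have q_eq: "q p = complex_of_real (\<bar>p\<bar> powr (\<mu> - 1)) * v p * cis (\<phi> p)" if "p \<noteq> 0" for p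
    proof -
      have "- \<i> * complex_of_real t * complex_of_real (f p) + \<i> * complex_of_real x * complex_of_real p
          = \<i> * complex_of_real (\<phi> p)"
        by (simp add: \<phi>_def algebra_simps)
      then show ?thesis
        unfolding q_def Fu0_eq[OF that] cis_conv_exp by (simp only:)
    qed
    \<comment> \<open>By monotonicity of \<open>f1\<close> the distance to \<open>a\<close> is
      smallest at the left end of the interval and the distance to \<open>b\<close> at the right
      end. The minimum in \<open>m_pos\<close> covers both sides of the cone.\<close>
    have near: "(\<forall>p\<in>{0..real n0}. t * m_pos f a b N \<le> x - t * f1 p) \<or>
        (\<forall>p\<in>{0..real n0}. x - t * f1 p \<le> - (t * m_pos f a b N))"
      using x
    proof
      assume x: "x < t * a"
      have "x - t * f1 p \<le> - (t * m_pos f a b N)" if "p \<in> {0..real n0}" for p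
      proof -
        have "m_pos f a b N \<le> f1 p - a"
          using f1_mono[of 0 p] that by (simp add: m_pos_def f1_def min_le_iff_disj)
        from mult_left_mono[OF this, of t] show ?thesis
          using t x by (simp add: algebra_simps)
      qed
      then show ?thesis by blast
    next
      assume x: "t * b < x"
      have "t * m_pos f a b N \<le> x - t * f1 p" if "p \<in> {0..real n0}" for p
      proof -
        have "m_pos f a b N \<le> b - f1 p"
          using f1_mono[of p N] that n0(1) by (simp add: m_pos_def f1_def min_le_iff_disj)
        from mult_left_mono[OF this, of t] show ?thesis
          using t x by (simp add: algebra_simps)
      qed
      then show ?thesis by blast
    qed
    have near_reflect: "(\<forall>p\<in>{0..real n0}. t * m_neg f a b N \<le> - (x - t * f1 (- p))) \<or>
        (\<forall>p\<in>{0..real n0}. - (x - t * f1 (- p)) \<le> - (t * m_neg f a b N))"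
      using x
    proof
      assume x: "x < t * a"
      have "t * m_neg f a b N \<le> - (x - t * f1 (- p))" if "p \<in> {0..real n0}" for p
      proof -
        have "m_neg f a b N \<le> f1 (- p) - a"
          using f1_mono[of "- N" "- p"] that n0(1) by (simp add: m_neg_def f1_def min_le_iff_disj)
        from mult_left_mono[OF this, of t] show ?thesis
          using t x by (simp add: algebra_simps)
      qed
      then show ?thesis by blast
    next
      assume x: "t * b < x"
      have "- (x - t * f1 (- p)) \<le> - (t * m_neg f a b N)" if "p \<in> {0..real n0}" for p
      proof -
        have "m_neg f a b N \<le> b - f1 (- p)"
          using f1_mono[of "- p" 0] that by (simp add: m_neg_def f1_def min_le_iff_disj)
        from mult_left_mono[OF this, of t] show ?thesis
          using t x by (simp add: algebra_simps)
      qed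
      then show ?thesis by blast
    qed
    \<comment> \<open>These are distances to the farther limit, which the decay of \<open>f2\<close>
      does not estimate directly. Since \<open>f1 (- p) \<le> f1 p\<close>, they are at least the
      distances to the nearer limit at the reflected point.\<close>
    have gap': "\<kappa> * p powr (1 - \<beta>\<^sub>m) \<le> b - f1 (- p)" "\<kappa> * p powr (1 - \<beta>\<^sub>m) \<le> f1 p - a"
      if "real n0 \<le> p" for p
      using gap[OF that] f1_mono[of "- p" p] that by auto
    have far: "(\<forall>p\<ge>real n0. t * (\<kappa> * p powr (1 - \<beta>\<^sub>m)) \<le> x - t * f1 p) \<or>
        (\<forall>p\<ge>real n0. x - t * f1 p \<le> - (t * (\<kappa> * p powr (1 - \<beta>\<^sub>m))))"
      using x
    proof
      assume x: "x < t * a"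
      have "x - t * f1 p \<le> - (t * (\<kappa> * p powr (1 - \<beta>\<^sub>m)))" if "real n0 \<le> p" for p
        using mult_left_mono[OF gap'(2)[OF that], of t] t x by (simp add: right_diff_distrib)
      then show ?thesis by blast
    next
      assume x: "t * b < x"
      have "t * (\<kappa> * p powr (1 - \<beta>\<^sub>m)) \<le> x - t * f1 p" if "real n0 \<le> p" for p
        using mult_left_mono[OF gap(1)[OF that], of t] t x by (simp add: right_diff_distrib)
      then show ?thesis by blast
    qed
    have far_reflect: "(\<forall>p\<ge>real n0. t * (\<kappa> * p powr (1 - \<beta>\<^sub>m)) \<le> - (x - t * f1 (- p))) \<or>
        (\<forall>p\<ge>real n0. - (x - t * f1 (- p)) \<le> - (t * (\<kappa> * p powr (1 - \<beta>\<^sub>m))))"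
      using x
    proof
      assume x: "x < t * a"
      have "t * (\<kappa> * p powr (1 - \<beta>\<^sub>m)) \<le> - (x - t * f1 (- p))" if "real n0 \<le> p" for p
        using mult_left_mono[OF gap(2)[OF that], of t] t x by (simp add: right_diff_distrib)
      then show ?thesis by blast
    next
      assume x: "t * b < x"
      have "- (x - t * f1 (- p)) \<le> - (t * (\<kappa> * p powr (1 - \<beta>\<^sub>m)))" if "real n0 \<le> p" for p
        using mult_left_mono[OF gap'(1)[OF that], of t] t x by (simp add: right_diff_distrib)
      then show ?thesis by blast
    qed
    define T where "T = 2 powr (\<beta>\<^sub>m - 1) * (4 * M + M') / \<kappa> * S * t powr (- 1)"
    define P where "P = (1 / \<mu> * Lp + (4 * Lp + Vp) / m_pos f a b N) * t powr (- \<mu>) + T"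
    define Q where "Q = (1 / \<mu> * Ln + (4 * Ln + Vn) / m_neg f a b N) * t powr (- \<mu>) + T"
    have S_eq: "(\<alpha> + 2 - \<mu> - \<beta>\<^sub>m) / (\<alpha> + 2 - \<mu> - \<beta>\<^sub>m - 1) = S"
      by (simp add: S_def algebra_simps)
    have T0: "0 \<le> T" using M(1) M'(1) \<kappa> S t by (simp add: T_def)
    have PQ0: "0 \<le> P + Q"
      using T0 nonneg m \<mu> by (simp add: P_def Q_def)
    have int_bound: "norm (integral {- real k..real k} q) \<le> P + Q"
      if k: "n0 \<le> k" and q_int: "q integrable_on {- real k..real k}" for k
    proof -
      have pos_int: "q integrable_on {0..real k}" and neg_int: "q integrable_on {- real k..0}"
        by (rule integrable_subinterval_real[OF q_int]; force)+
      have "norm (integral {0..real k} q) \<le> P"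
        unfolding P_def T_def S_eq[symmetric]
      proof (rule half_line_bound[OF n0(2) k \<mu> t m(2) \<kappa> \<beta>1 \<alpha> v v1 \<phi> \<phi>1 \<phi>2 near far Lp _ _
            D1_decay(1) M(1) M'(1) _ pos_int])
        show "norm (v p) \<le> M * p powr (- \<alpha>)" if "real n0 \<le> p" for p
          using v_decay[of p] that n0(2) by simp
        show "q p = complex_of_real (p powr (\<mu> - 1)) * v p * cis (\<phi> p)" if "0 < p" for p
          using q_eq[of p] that by simp
      qed (simp_all add: Vp_eq)
      moreover have "norm (integral {0..real k} (\<lambda>p. q (- p))) \<le> Q"
        unfolding Q_def T_def S_eq[symmetric]
      proof (rule half_line_bound[OF n0(2) k \<mu> t m(1) \<kappa> \<beta>1 \<alpha> v_reflect v1_reflect \<phi>_reflect \<phi>1_reflect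
            \<phi>2 near_reflect far_reflect Ln _ _ _ M(1) M'(1)])
        show "norm (v (- p)) \<le> M * p powr (- \<alpha>)" if "real n0 \<le> p" for p
          using v_decay[of "- p"] that n0(2) by simp
        show "integral {real n..real n + 1} (\<lambda>p. norm (- D1 v (- p))) \<le> M' * real n powr (- \<alpha>)" if "n0 \<le> n" for n
          using D1_decay(2)[OF that] unfolding integral_reflect .
        show "q (- p) = complex_of_real (p powr (\<mu> - 1)) * v (- p) * cis (\<phi> (- p))" if "0 < p" for p
          using q_eq[of "- p"] that by simp
        show "(\<lambda>p. q (- p)) integrable_on {0..real k}"
          using neg_int Henstock_Kurzweil_Integration.integrable_reflect_real[of q 0 "- real k"] by simp
      qed (simp_all add: Vn_eq del: norm_minus_cancel)
      moreover have "integral {- real k..real k} q = integral {- real k..0} q + integral {0..real k} q"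
        using q_int by (intro Henstock_Kurzweil_Integration.integral_combine[symmetric]) auto
      moreover have "integral {- real k..0} q = integral {0..real k} (\<lambda>p. q (- p))"
        using Henstock_Kurzweil_Integration.integral_reflect_real[of "real k" 0 "\<lambda>p. q (- p)"] by simp
      ultimately show ?thesis
        using norm_triangle_ineq[of "integral {- real k..0} q" "integral {0..real k} q"] by simp
    qed
    have "norm (LINT p|lborel. q p) \<le> P + Q"
    proof (cases "integrable lborel q")
      case True
      have hi: "(q has_integral (LINT p|lborel. q p)) UNIV"
        by (rule has_integral_integral_lborel[OF True])
      show ?thesis
      proof (rule norm_has_integral_UNIV_le[OF hi])
        show "norm (integral {- real k..real k} q) \<le> P + Q" if "n0 \<le> k" for k
          using int_bound[OF that] integrable_on_subcbox[of q UNIV "- real k" "real k"] hi by auto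
      qed
    next
      \<comment> \<open>A non-integrable \<open>q\<close> has Bochner integral \<open>0\<close> by convention, so its integrability need not be checked.\<close>
      case False
      then show ?thesis using PQ0 by (simp add: not_integrable_integral_eq)
    qed
    moreover have "norm (u t x) = 1 / (2 * pi) * norm (LINT p|lborel. q p)"
      unfolding u[OF t] solution_def q_def[symmetric] by (simp add: norm_mult norm_divide)
    ultimately have "norm (u t x) \<le> 1 / (2 * pi) * (P + Q)"
      by (simp add: divide_right_mono)
    \<comment> \<open>Both half-lines contribute the same \<open>T\<close>, so the prefactor
      \<open>1 / (2 * pi)\<close> leaves \<open>1 / pi * T\<close>.\<close>
    also have "\<dots> = c1 f a b N \<mu> v * t powr (- \<mu>) + 1 / pi * T"
    proof -
      have c1_eq: "c1 f a b N \<mu> v = 1 / (2 * pi) * (1 / \<mu> * Lp + (4 * Lp + Vp) / m_pos f a b N)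
          + 1 / (2 * pi) * (1 / \<mu> * Ln + (4 * Ln + Vn) / m_neg f a b N)"
        unfolding c1_def Ln_def[symmetric] Lp_def[symmetric] Vn_def[symmetric] Vp_def[symmetric]
        by (simp only: divide_inverse distrib_left distrib_right mult.assoc mult_1 add_ac)
      have "1 / (2 * pi) * ((X * y + T) + (Y * y + T)) = (1 / (2 * pi) * X + 1 / (2 * pi) * Y) * y + 1 / pi * T" for X Y y
        by (simp add: field_simps)
      then show ?thesis unfolding P_def Q_def c1_eq .
    qed
    also have "1 / pi * T \<le> c2 c\<^sub>m \<beta>\<^sub>m \<mu> \<alpha> M M' * t powr (- 1)"
    proof -
      \<comment> \<open>The constant found here is smaller than the one in \<open>c2\<close>. As
        \<open>\<mu> \<le> 1\<close> and \<open>\<alpha> > 0\<close>, both exponents there are at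
        least \<open>\<beta>\<^sub>m - 1\<close>; of the four copies of \<open>M\<close>, three
        match the first summand and one matches \<open>2 powr \<alpha> * M\<close> in the
        second.\<close>
      have "2 powr (\<beta>\<^sub>m - 1) \<le> 2 powr (- \<mu> + \<alpha> + \<beta>\<^sub>m)" "2 powr (\<beta>\<^sub>m - 1) \<le> 2 powr (- \<mu> + \<beta>\<^sub>m)"
        using \<alpha> \<mu> \<beta>1 by (auto intro!: powr_mono)
      then have "2 powr (\<beta>\<^sub>m - 1) * M \<le> 2 powr (- \<mu> + \<alpha> + \<beta>\<^sub>m) * M"
          "2 powr (\<beta>\<^sub>m - 1) * M' \<le> 2 powr (- \<mu> + \<beta>\<^sub>m) * M'"
        using M(1) M'(1) by (auto intro: mult_right_mono)
      moreover have "2 powr (- \<mu> + \<beta>\<^sub>m) * (2 powr \<alpha> * M) = 2 powr (- \<mu> + \<alpha> + \<beta>\<^sub>m) * M"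
        by (simp only: mult.assoc[symmetric] powr_add[symmetric] add_ac)
      ultimately have *: "2 powr (\<beta>\<^sub>m - 1) * (4 * M + M')
          \<le> 3 * 2 powr (- \<mu> + \<alpha> + \<beta>\<^sub>m) * M + 2 powr (- \<mu> + \<beta>\<^sub>m) * (2 powr \<alpha> * M + M')"
        unfolding distrib_left by linarith
      have "1 / pi * T = (\<beta>\<^sub>m - 1) / (pi * c\<^sub>m) * (2 powr (\<beta>\<^sub>m - 1) * (4 * M + M')) * S * t powr (- 1)"
        by (simp add: T_def \<kappa>_def divide_inverse)
      also have "\<dots> \<le> (\<beta>\<^sub>m - 1) / (pi * c\<^sub>m) * (3 * 2 powr (- \<mu> + \<alpha> + \<beta>\<^sub>m) * M
          + 2 powr (- \<mu> + \<beta>\<^sub>m) * (2 powr \<alpha> * M + M')) * S * t powr (- 1)"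
        using \<beta>1 c S by (intro mult_right_mono mult_left_mono *) auto
      finally show ?thesis by (simp only: c2_def S_def)
    qed
    finally show ?thesis by simp
  qed

  have "norm (u t x) \<le> c1 f a b N \<mu> v * t powr (- \<mu>) + c2 c\<^sub>m \<beta>\<^sub>m \<mu> \<alpha> M M' * t powr (- 1)"
    if "(t, x) \<in> cone_compl a b" for t x
  proof (rule bound)
    show "0 < t" using that by (simp add: cone_compl_def)
    with that show "x < t * a \<or> t * b < x"
      by (auto simp: cone_compl_def cone_def field_simps)
  qed
  moreover have "a < b" using f1_less[of 0] f1_greater[of 0] by simp
  ultimately show ?thesis
    using l l'_bot m by (auto simp: a_eq b_eq f1_def)
qed

end
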